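(* Let $I\supset[0,\infty)$ be an open interval and let $f:I\to(0,\infty)$ be a differentiable function on $I$ such that $f'\in L(a,b)$, where $0\le a<b<\infty$. Let $(\alpha,m)\in(0,1]^2$ and suppose that $|f'(x)|$ is $(\alpha,m)$-logarithmically convex on $\left[0,\frac bm\right]$. Put $\eta=|f'(a)|\,/\,\left|f'\left(\frac bm\right)\right|^m$. Then: if $\eta=1$, $$\left|\frac{f(a)+f(b)}{2}-\frac1{b-a}\int_a^b f(x)\,dx\right|\le \frac{b-a}{3}\left|f'\left(\tfrac bm\right)\right|^m;$$ if $\eta<1$, $$\left|\frac{f(a)+f(b)}{2}-\frac1{b-a}\int_a^b f(x)\,dx\right|\le \frac{b-a}{2}\left|f'\left(\tfrac bm\right)\right|^m\,\frac{-\alpha^2(\ln\eta)^2-2\alpha\ln\eta+2\eta^\alpha-2}{\alpha^3(\ln\eta)^3}.$$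
   Context: For $(\alpha,m)\in(0,1]\times(0,1]$ and $c>0$, a function $g:[0,c]\to(0,\infty)$ is $(\alpha,m)$-logarithmically convex on $[0,c]$ if $g(tx+m(1-t)y)\le [g(x)]^{t^\alpha}[g(y)]^{m(1-t^\alpha)}$ for all $x,y\in[0,c]$ and $t\in[0,1]$. In particular such a function is strictly positive. $L(a,b)$ denotes the (Lebesgue) integrable functions on $(a,b)$. *)

theory Defs
  imports "HOL-Analysis.Analysis"
begin

(* Intended for 0 < alpha <= 1, 0 < m <= 1 and c > 0; then t * x + m * (1 - t) * y stays in {0..c}.
   Positivity of g is part of the notion (g maps into the positive reals), and makes powr the
   genuine real power; at t = 0, 0 powr alpha = 0 is the usual value since alpha > 0. *)
definition alpha_m_log_convex_on ::
    "real \<Rightarrow> real \<Rightarrow> real \<Rightarrow> (real \<Rightarrow> real) \<Rightarrow> bool" where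
  "alpha_m_log_convex_on \<alpha> m c g \<longleftrightarrow>
     (\<forall>x\<in>{0..c}. 0 < g x) \<and>
     (\<forall>x\<in>{0..c}. \<forall>y\<in>{0..c}. \<forall>t\<in>{0..1}.
        g (t * x + m * (1 - t) * y)
          \<le> g x powr (t powr \<alpha>) * g y powr (m * (1 - t powr \<alpha>)))"

end

(*
  A nonvanishing derivative has constant sign, so with F t = f (t a + (1 - t) b) the trapezoid
  error is half the integral of (1 - 2 t) |F' t|, up to sign, and there is cancellation.
  Log-convexity gives |F' t| <= A w t with w t = exp (u t), u = alpha ln eta <= 0
  and A = (b - a) |f' (b / m)|^m.  For eta < 1 the claimed bound is A / 2 times the integral of
  (1 - t)^2 w t (a Taylor remainder of exp); for eta = 1 it is twice that.  One sign of the error is handled by 1 - 2 t <= (1 - t)^2.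
  For the other, 2 t - 1 <= t^2 = (1 - t)^2 + (2 t - 1), and since w is decreasing
  (2 t - 1) w t <= (2 t - 1) w (1/2), which integrates to 0.
*)

theory Submission
  imports Defs
begin

lemma nonvanishing_deriv_pos_or_neg:
  fixes f f' :: "real \<Rightarrow> real"
  assumes S: "is_interval S"
    and der: "\<And>x. x \<in> S \<Longrightarrow> DERIV f x :> f' x"
    and nz: "\<And>x. x \<in> S \<Longrightarrow> f' x \<noteq> 0"
  shows "(\<forall>x\<in>S. 0 < f' x) \<or> (\<forall>x\<in>S. f' x < 0)"
proof -
  have key: "g' q > 0"
    if g: "\<And>x. x \<in> {p..q} \<Longrightarrow> DERIV g x :> g' x" "\<And>x. x \<in> {p..q} \<Longrightarrow> g' x \<noteq> 0"
      and "g' p > 0" "p < q" for g g' :: "real \<Rightarrow> real" and p q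
  proof (rule ccontr)
    assume "\<not> g' q > 0"
    with g(2)[of q] \<open>p < q\<close> have "g' q < 0" by force
    have "continuous_on {p..q} g"
      using g(1) by (intro continuous_at_imp_continuous_on ballI DERIV_isCont)
    then obtain c where c: "c \<in> {p..q}" "\<And>y. y \<in> {p..q} \<Longrightarrow> g y \<le> g c"
      using continuous_attains_sup[of "{p..q}" g] \<open>p < q\<close> by auto
    have "c \<noteq> p"
    proof
      assume "c = p"
      obtain d where d: "d > 0" "\<And>h. h > 0 \<Longrightarrow> h < d \<Longrightarrow> g p < g (p + h)"
        using DERIV_pos_inc_right[OF g(1) \<open>g' p > 0\<close>] \<open>p < q\<close> by auto
      \<comment> \<open>The cap \<open>d / 2\<close> keeps the step strictly below \<open>d\<close>;
        the cap \<open>q - p\<close> keeps the new point in the segment on which \<open>c\<close> is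
        maximal.\<close>
      define h where "h = min (d / 2) (q - p)"
      have "g p < g (p + h)" using d \<open>p < q\<close> by (intro d(2)) (auto simp: h_def)
      moreover have "g (p + h) \<le> g p"
        using c(2)[of "p + h"] \<open>c = p\<close> d(1) \<open>p < q\<close> by (auto simp: h_def)
      ultimately show False by simp
    qed
    moreover have "c \<noteq> q"
    proof
      assume "c = q"
      obtain d where d: "d > 0" "\<And>h. h > 0 \<Longrightarrow> h < d \<Longrightarrow> g q < g (q - h)"
        using DERIV_neg_dec_left[OF g(1) \<open>g' q < 0\<close>] \<open>p < q\<close> by auto
      define h where "h = min (d / 2) (q - p)"
      have "g q < g (q - h)" using d \<open>p < q\<close> by (intro d(2)) (auto simp: h_def)
      moreover have "g (q - h) \<le> g q"
        using c(2)[of "q - h"] \<open>c = q\<close> d(1) \<open>p < q\<close> by (auto simp: h_def)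
      ultimately show False by simp
    qed
    ultimately have pc: "p < c" "c < q" using c(1) by auto
    have "g' c = 0"
      by (rule DERIV_local_max[OF g(1)[OF c(1)], of "min (c - p) (q - c)"])
        (use pc in \<open>auto intro!: c(2)\<close>)
    with g(2) c(1) show False by blast
  qed
  show ?thesis
  proof (rule ccontr)
    assume "\<not> ?thesis"
    then obtain x y where xy: "x \<in> S" "y \<in> S" "f' x < 0" "f' y > 0"
      using nz by (metis linorder_neqE_linordered_idom)
    have sub: "{p..q} \<subseteq> S" if "p \<in> S" "q \<in> S" for p q
      using mem_is_interval_1_I[OF S that] by auto
    consider "x < y" | "y < x" using xy by force
    then show False
    proof cases
      case 1
      \<comment> \<open>\<open>key\<close> needs a positive slope at the left end, hence the passage
        to \<open>-f\<close> in this order of \<open>x\<close> and \<open>y\<close>.\<close>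
      have "- f' y > 0"
        by (rule key[where p = x and g = "\<lambda>x. - f x" and g' = "\<lambda>x. - f' x"])
          (use 1 xy sub[of x y] nz in \<open>auto intro!: DERIV_minus der\<close>)
      with xy show False by simp
    next
      case 2
      have "f' x > 0"
        by (rule key[where p = y and g = f])
          (use 2 xy sub[of y x] nz in \<open>auto intro!: der\<close>)
      with xy show False by simp
    qed
  qed
qed

text \<open>Two integrations by parts give the antiderivative \<open>?G\<close>. The value is 2 /
  u^3 times exp u - 1 - u - u^2 / 2, the second-order Taylor remainder at 0.\<close>

lemma has_integral_taylor_remainder_exp:
  fixes u :: real
  assumes "u \<noteq> 0"
  shows "((\<lambda>t. (1 - t)\<^sup>2 * exp (u * t)) has_integral
           (- u\<^sup>2 - 2 * u + 2 * exp u - 2) / u ^ 3) {0..1}"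
proof -
  define c where "c = 1 / u"
  have uc: "u * c = 1" using assms by (simp add: c_def)
  let ?G = "\<lambda>t. exp (u * t) * (c * (1 - t)\<^sup>2 + 2 * c\<^sup>2 * (1 - t) + 2 * c ^ 3)"
  have "((\<lambda>t. (1 - t)\<^sup>2 * exp (u * t)) has_integral ?G 1 - ?G 0) {0..1}"
  proof (rule fundamental_theorem_of_calculus)
    fix t :: real
    \<comment> \<open>\<open>?p\<close> is the factor of \<open>exp (u * t)\<close> in the
      derivative of \<open>?G\<close>: u times the bracket plus the derivative of the bracket. With
      \<open>c\<close> in place of 1 / u, its value is a polynomial consequence of
      \<open>u * c = 1\<close>.\<close>
    let ?p = "u * (c * (1 - t)\<^sup>2 + 2 * c\<^sup>2 * (1 - t) + 2 * c ^ 3) - 2 * c * (1 - t) - 2 * c\<^sup>2"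
    have "?p = (1 - t)\<^sup>2" using uc by algebra
    then have G': "(1 - t)\<^sup>2 * exp (u * t) = ?p * exp (u * t)" by simp
    show "(?G has_vector_derivative (1 - t)\<^sup>2 * exp (u * t)) (at t within {0..1})"
      unfolding has_real_derivative_iff_has_vector_derivative[symmetric] G'
      by (auto intro!: derivative_eq_intros simp: algebra_simps)
  qed simp
  also have "?G 1 - ?G 0 = (- u\<^sup>2 - 2 * u + 2 * exp u - 2) / u ^ 3"
    using assms by (simp add: c_def field_simps power2_eq_square power3_eq_cube)
  finally show ?thesis .
qed

text \<open>This covers the exponent u = 0, that is \<eta> = 1, where the closed form above would
  divide by zero.\<close>

lemma has_integral_power2_one_minus:
  "((\<lambda>t::real. (1 - t)\<^sup>2) has_integral 1 / 3) {0..1}"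
proof -
  have "((\<lambda>t::real. (1 - t)\<^sup>2) has_integral - ((1 - 1) ^ 3) / 3 - (- ((1 - 0) ^ 3) / 3)) {0..1}"
  proof (rule fundamental_theorem_of_calculus)
    fix t :: real
    show "((\<lambda>t. - ((1 - t) ^ 3) / 3) has_vector_derivative (1 - t)\<^sup>2) (at t within {0..1})"
      unfolding has_real_derivative_iff_has_vector_derivative[symmetric]
      by (auto intro!: derivative_eq_intros)
  qed simp
  then show ?thesis by simp
qed

text \<open>Since \<open>F'\<close> is nonnegative, the kernel 1 - 2t can be estimated from above
  for each sign of the error separately, which keeps the cancellation that |1 - 2t| would
  destroy.\<close>

lemma trapezoid_error_le:
  fixes F F' :: "real \<Rightarrow> real"
  assumes der: "\<And>t. t \<in> {0..1} \<Longrightarrow> DERIV F t :> F' t"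
    and nonneg: "\<And>t. t \<in> {0..1} \<Longrightarrow> 0 \<le> F' t"
    and le: "\<And>t. t \<in> {0..1} \<Longrightarrow> F' t \<le> A * exp (u * t)"
    and A: "0 \<le> A" and u: "u \<le> 0"
    and J: "((\<lambda>t. (1 - t)\<^sup>2 * exp (u * t)) has_integral J) {0..1}"
  shows "\<bar>(F 0 + F 1) / 2 - integral {0..1} F\<bar> \<le> A / 2 * J"
proof -
  let ?K = "2 * integral {0..1} F - (F 0 + F 1)"
  let ?w = "\<lambda>t. exp (u * t)"
  have "continuous_on {0..1} F"
    using der by (intro continuous_at_imp_continuous_on ballI DERIV_isCont)
  then have F: "(F has_integral integral {0..1} F) {0..1}"
    by (intro integrable_integral integrable_continuous_real)
  \<comment> \<open>Integration by parts, read off from the derivative of (1 - 2t) F t. The gauge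
    integral supplies integrability from the antiderivative.\<close>
  have "((\<lambda>t. (1 - 2 * t) * F' t - 2 * F t) has_integral (1 - 2 * 1) * F 1 - (1 - 2 * 0) * F 0) {0..1}"
  proof (rule fundamental_theorem_of_calculus)
    fix t :: real assume "t \<in> {0..1}"
    then show "((\<lambda>t. (1 - 2 * t) * F t) has_vector_derivative (1 - 2 * t) * F' t - 2 * F t)
        (at t within {0..1})"
      unfolding has_real_derivative_iff_has_vector_derivative[symmetric]
      by (auto intro!: derivative_eq_intros has_field_derivative_at_within[OF der])
  qed simp
  from has_integral_add[OF this has_integral_mult_right[OF F, of 2]]
  have K: "((\<lambda>t. (1 - 2 * t) * F' t) has_integral ?K) {0..1}"
    by (simp add: algebra_simps)
  have AJ: "((\<lambda>t. A * ((1 - t)\<^sup>2 * ?w t)) has_integral A * J) {0..1}"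
    by (rule has_integral_mult_right[OF J])
  have upper: "?K \<le> A * J"
  proof (rule has_integral_le[OF K AJ])
    fix t :: real assume t: "t \<in> {0..1}"
    have "(1 - 2 * t) * F' t \<le> (1 - t)\<^sup>2 * F' t"
      by (intro mult_right_mono nonneg t) (simp add: power2_eq_square algebra_simps)
    also have "\<dots> \<le> (1 - t)\<^sup>2 * (A * ?w t)"
      by (intro mult_left_mono le t) simp
    finally show "(1 - 2 * t) * F' t \<le> A * ((1 - t)\<^sup>2 * ?w t)" by (simp add: mult_ac)
  qed
  have "((\<lambda>t::real. 2 * t - 1) has_integral (1\<^sup>2 - 1) - (0\<^sup>2 - 0)) {0..1}"
  proof (rule fundamental_theorem_of_calculus)
    fix t :: real
    show "((\<lambda>t. t\<^sup>2 - t) has_vector_derivative 2 * t - 1) (at t within {0..1})"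
      unfolding has_real_derivative_iff_has_vector_derivative[symmetric]
      by (auto intro!: derivative_eq_intros)
  qed simp
  \<comment> \<open>The added multiple of 2t - 1 has integral zero, so it corrects the majorant
    pointwise without changing the bound.\<close>
  from has_integral_add[OF AJ has_integral_mult_right[OF this, of "A * ?w (1/2)"]]
  have AJ': "((\<lambda>t. A * ((1 - t)\<^sup>2 * ?w t) + A * ?w (1/2) * (2 * t - 1)) has_integral A * J) {0..1}"
    by simp
  have lower: "- ?K \<le> A * J"
  proof (rule has_integral_le[OF has_integral_neg[OF K] AJ'])
    fix t :: real assume t: "t \<in> {0..1}"
    have "- ((1 - 2 * t) * F' t) = (2 * t - 1) * F' t" by (simp add: algebra_simps)
    \<comment> \<open>The upper bound on \<open>F'\<close> may only be inserted under a nonnegative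
      kernel; 2t - 1 changes sign, so it is first raised to t^2 and split off again
      afterwards.\<close>
    also have "\<dots> \<le> t\<^sup>2 * F' t"
    proof (intro mult_right_mono nonneg t)
      have "0 \<le> (t - 1)\<^sup>2" by simp
      then show "2 * t - 1 \<le> t\<^sup>2" by (simp add: power2_eq_square algebra_simps)
    qed
    also have "\<dots> \<le> t\<^sup>2 * (A * ?w t)"
      by (intro mult_left_mono le t) simp
    also have "\<dots> = A * ((1 - t)\<^sup>2 * ?w t + (2 * t - 1) * ?w t)"
      by (simp add: power2_eq_square algebra_simps)
    also have "\<dots> \<le> A * ((1 - t)\<^sup>2 * ?w t + (2 * t - 1) * ?w (1/2))"
    proof (rule mult_left_mono[OF add_left_mono A])
      \<comment> \<open>Both factors change sign at 1/2 in the same direction, because the weight is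
        nonincreasing for \<open>u \<le> 0\<close>.\<close>
      have "0 \<le> (t - 1/2) * (?w (1/2) - ?w t)"
      proof (cases "t \<le> 1/2")
        case True
        then have "?w (1/2) \<le> ?w t" using u mult_left_mono_neg[of t "1/2" u] by simp
        with True show ?thesis by (intro mult_nonpos_nonpos) auto
      next
        case False
        then have "?w t \<le> ?w (1/2)" using u mult_left_mono_neg[of "1/2" t u] by simp
        with False show ?thesis by (intro mult_nonneg_nonneg) auto
      qed
      then show "(2 * t - 1) * ?w t \<le> (2 * t - 1) * ?w (1/2)" by (simp add: algebra_simps)
    qed
    finally show "- ((1 - 2 * t) * F' t) \<le> A * ((1 - t)\<^sup>2 * ?w t) + A * ?w (1/2) * (2 * t - 1)"
      by (simp add: algebra_simps)
  qed
  show ?thesis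
  proof (rule abs_leI)
    show "(F 0 + F 1) / 2 - integral {0..1} F \<le> A / 2 * J"
      using lower by (simp add: field_simps)
    show "- ((F 0 + F 1) / 2 - integral {0..1} F) \<le> A / 2 * J"
      using upper by (simp add: field_simps)
  qed
qed

text \<open>Substitution t = (b - x) / (b - a). The reversed orientation makes t the weight of
  \<open>a\<close>, as in the convexity inequality.\<close>

lemma integral_reverse_unit_interval:
  fixes f :: "real \<Rightarrow> real"
  assumes "a < b" "f integrable_on {a..b}"
  shows "integral {0..1} (\<lambda>t. f (b - (b - a) * t)) = 1 / (b - a) * integral {a..b} f"
proof -
  have "(f has_integral integral {a..b} f) (cbox a b)"
    using assms(2) by (simp add: integrable_integral)
  from has_integral_affinity[OF this, of "-(b - a)" b] assms(1)
  have "((\<lambda>t. f (b - (b - a) * t)) has_integral 1 / (b - a) * integral {a..b} f)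
      ((\<lambda>x. (1 / - (b - a)) * x + - ((1 / - (b - a)) * b)) ` {a..b})"
    by (simp add: algebra_simps)
  also have "(\<lambda>x. (1 / - (b - a)) * x + - ((1 / - (b - a)) * b)) = (\<lambda>x. (b - x) / (b - a))"
  proof
    fix x
    show "(1 / - (b - a)) * x + - ((1 / - (b - a)) * b) = (b - x) / (b - a)"
      unfolding minus_divide_right[symmetric] diff_divide_distrib by simp
  qed
  also have "(\<lambda>x. (b - x) / (b - a)) ` {a..b} = {0..1}"
  proof (intro equalityI subsetI)
    fix t :: real assume t: "t \<in> {0..1}"
    then have "(b - a) * t \<le> (b - a) * 1" "0 \<le> (b - a) * t"
      using assms(1) by (auto intro: mult_left_mono)
    then have "b - (b - a) * t \<in> {a..b}" by simp
    moreover have "t = (b - (b - (b - a) * t)) / (b - a)" using assms(1) by simp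
    ultimately show "t \<in> (\<lambda>x. (b - x) / (b - a)) ` {a..b}" by (rule rev_image_eqI)
  qed (use assms(1) in \<open>auto simp: field_simps\<close>)
  finally show ?thesis by (rule integral_unique)
qed

lemma trapezoid_error_le_exp:
  fixes f f' :: "real \<Rightarrow> real"
  assumes ab: "a < b"
    and der: "\<And>x. x \<in> {a..b} \<Longrightarrow> DERIV f x :> f' x"
    and nz: "\<And>x. x \<in> {a..b} \<Longrightarrow> f' x \<noteq> 0"
    and le: "\<And>t. t \<in> {0..1} \<Longrightarrow> \<bar>f' (b - (b - a) * t)\<bar> \<le> M * exp (u * t)"
    and u: "u \<le> 0"
    and J: "((\<lambda>t. (1 - t)\<^sup>2 * exp (u * t)) has_integral J) {0..1}"
  shows "\<bar>(f a + f b) / 2 - 1 / (b - a) * integral {a..b} f\<bar> \<le> (b - a) / 2 * M * J"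
proof -
  let ?p = "\<lambda>t. b - (b - a) * t"
  have p: "?p t \<in> {a..b}" if "t \<in> {0..1}" for t
  proof -
    have "(b - a) * t \<le> (b - a) * 1" "0 \<le> (b - a) * t"
      using that ab by (auto intro: mult_left_mono)
    then show ?thesis by simp
  qed
  \<comment> \<open>At t = 0 the exponential is 1, so \<open>M\<close> dominates an absolute
    value.\<close>
  have M: "0 \<le> M" using le[of 0] by (simp add: order_trans[OF abs_ge_zero])
  have "continuous_on {a..b} f"
    using der by (intro continuous_at_imp_continuous_on ballI DERIV_isCont)
  then have int: "integral {0..1} (\<lambda>t. f (?p t)) = 1 / (b - a) * integral {a..b} f"
    by (intro integral_reverse_unit_interval ab integrable_continuous_real)
  have der_p: "DERIV (\<lambda>t. s * f (?p t)) t :> - s * (b - a) * f' (?p t)" if "t \<in> {0..1}" for s t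
  proof -
    have "DERIV ?p t :> - (b - a)" by (auto intro!: derivative_eq_intros)
    from DERIV_cmult[OF DERIV_chain2[OF der[OF p[OF that]] this], of s]
    show ?thesis by (rule DERIV_cong) (simp add: algebra_simps)
  qed
  \<comment> \<open>The sign \<open>s\<close> makes the derivative of \<open>s * f (?p t)\<close>
    nonnegative. As \<open>?p\<close> reverses orientation, an increasing \<open>f\<close> takes s =
    -1 and a decreasing one s = 1.\<close>
  have bound: "\<bar>(f a + f b) / 2 - 1 / (b - a) * integral {a..b} f\<bar> \<le> (b - a) / 2 * M * J"
    if s: "\<bar>s\<bar> = 1" "\<And>x. x \<in> {a..b} \<Longrightarrow> 0 \<le> - s * f' x" for s
  proof -
    have "\<bar>(s * f (?p 0) + s * f (?p 1)) / 2 - integral {0..1} (\<lambda>t. s * f (?p t))\<bar>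
        \<le> (b - a) * M / 2 * J"
    proof (rule trapezoid_error_le[OF der_p _ _ _ u J])
      fix t :: real assume t: "t \<in> {0..1}"
      have *: "- s * (b - a) * f' (?p t) = (b - a) * (- s * f' (?p t))" by simp
      show "0 \<le> - s * (b - a) * f' (?p t)"
        unfolding * by (rule mult_nonneg_nonneg) (use ab s(2)[OF p[OF t]] in auto)
      have "- s * f' (?p t) \<le> \<bar>- s * f' (?p t)\<bar>" by (rule abs_ge_self)
      also have "\<dots> \<le> M * exp (u * t)" using le[OF t] s(1) by (simp add: abs_mult)
      finally show "- s * (b - a) * f' (?p t) \<le> (b - a) * M * exp (u * t)"
        unfolding * mult.assoc[of "b - a"] using ab by (intro mult_left_mono) auto
    qed (use ab M in auto)
    then have "\<bar>s * ((f a + f b) / 2 - 1 / (b - a) * integral {a..b} f)\<bar> \<le> (b - a) * M / 2 * J"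
      unfolding int[symmetric] by (simp add: algebra_simps add_divide_distrib)
    then show ?thesis using s(1) by (simp add: abs_mult)
  qed
  consider "\<forall>x\<in>{a..b}. 0 < f' x" | "\<forall>x\<in>{a..b}. f' x < 0"
    using nonvanishing_deriv_pos_or_neg[of "{a..b}" f f'] der nz is_interval_cc by blast
  then show ?thesis
  proof cases
    case 1
    then show ?thesis by (intro bound[of "-1"]) (auto intro: less_imp_le)
  next
    case 2
    then show ?thesis by (intro bound[of 1]) (auto intro: less_imp_le)
  qed
qed

text \<open>The convexity bound equals g(y)^m times \<eta> to the power t^\<alpha>. On [0,1] one has
  t^\<alpha> \<ge> t \<ge> \<alpha> t, and ln \<eta> \<le> 0 turns this into an upper bound with an
  exponent linear in t.\<close>

lemma alpha_m_log_convex_on_segment_le: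
  fixes g :: "real \<Rightarrow> real"
  assumes conv: "alpha_m_log_convex_on \<alpha> m c g"
    and \<alpha>: "0 < \<alpha>" "\<alpha> \<le> 1"
    and xy: "x \<in> {0..c}" "y \<in> {0..c}"
    and \<eta>: "\<eta> = g x / g y powr m" "\<eta> \<le> 1"
    and t: "t \<in> {0..1}"
  shows "g (t * x + m * (1 - t) * y) \<le> g y powr m * exp (\<alpha> * ln \<eta> * t)"
proof -
  have pos: "0 < g x" "0 < g y" using conv xy by (auto simp: alpha_m_log_convex_on_def)
  then have \<eta>_pos: "0 < \<eta>" by (simp add: \<eta>(1))
  have "\<alpha> * t \<le> t powr \<alpha>"
  proof (cases "t = 0")
    case False
    have "\<alpha> * t \<le> t" using \<alpha> t by (simp add: mult_left_le_one_le)
    also have "t = t powr 1" using t by simp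
    also have "\<dots> \<le> t powr \<alpha>" using \<alpha> t False by (intro powr_mono') auto
    finally show ?thesis .
  qed simp
  then have "t powr \<alpha> * ln \<eta> \<le> \<alpha> * t * ln \<eta>"
    using \<eta>(2) \<eta>_pos by (intro mult_right_mono_neg) auto
  then have "\<eta> powr (t powr \<alpha>) \<le> exp (\<alpha> * ln \<eta> * t)"
    using \<eta>_pos by (simp add: powr_def mult_ac)
  have "g (t * x + m * (1 - t) * y) \<le> g x powr (t powr \<alpha>) * g y powr (m * (1 - t powr \<alpha>))"
    using conv xy t unfolding alpha_m_log_convex_on_def by blast
  also have "\<dots> = g y powr m * \<eta> powr (t powr \<alpha>)"
    using pos by (simp add: \<eta>(1) powr_divide powr_powr right_diff_distrib powr_diff)
  also have "\<dots> \<le> g y powr m * exp (\<alpha> * ln \<eta> * t)"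
    by (intro mult_left_mono) (fact, simp)
  finally show ?thesis .
qed

theorem theorem1:
  fixes I :: "real set" and f :: "real \<Rightarrow> real" and a b \<alpha> m \<eta> :: real
  assumes I: "open I" "is_interval I" "{0..} \<subseteq> I"
    and f_pos: "\<And>x. x \<in> I \<Longrightarrow> 0 < f x"
    and f_diff: "\<And>x. x \<in> I \<Longrightarrow> f differentiable (at x)"
    and ab: "0 \<le> a" "a < b"
    and f'_int: "deriv f absolutely_integrable_on {a<..<b}"
    and \<alpha>: "0 < \<alpha>" "\<alpha> \<le> 1"
    and m: "0 < m" "m \<le> 1"
    and f'_conv: "alpha_m_log_convex_on \<alpha> m (b / m) (\<lambda>x. \<bar>deriv f x\<bar>)"
    and \<eta>: "\<eta> = \<bar>deriv f a\<bar> / \<bar>deriv f (b / m)\<bar> powr m"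
  shows "(\<eta> = 1 \<longrightarrow>
            \<bar>(f a + f b) / 2 - 1 / (b - a) * integral {a..b} f\<bar>
              \<le> (b - a) / 3 * \<bar>deriv f (b / m)\<bar> powr m) \<and>
         (\<eta> < 1 \<longrightarrow>
            \<bar>(f a + f b) / 2 - 1 / (b - a) * integral {a..b} f\<bar>
              \<le> (b - a) / 2 * \<bar>deriv f (b / m)\<bar> powr m *
                ((- (\<alpha>\<^sup>2 * (ln \<eta>)\<^sup>2) - 2 * \<alpha> * ln \<eta> + 2 * \<eta> powr \<alpha> - 2) /
                 (\<alpha> ^ 3 * (ln \<eta>) ^ 3)))"
proof -
  let ?M = "\<bar>deriv f (b / m)\<bar> powr m"
  let ?u = "\<alpha> * ln \<eta>"
  have "b * m \<le> b * 1" using ab m by (intro mult_left_mono) auto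
  then have b_le: "b \<le> b / m" using m by (simp add: field_simps)
  have pos: "0 < \<bar>deriv f x\<bar>" if "x \<in> {0..b / m}" for x
    using f'_conv that by (simp add: alpha_m_log_convex_on_def)
  have a_in: "a \<in> {0..b / m}" and b_in: "b / m \<in> {0..b / m}" using ab b_le by auto
  have \<eta>_pos: "0 < \<eta>" using pos[OF a_in] pos[OF b_in] by (simp add: \<eta>)
  \<comment> \<open>Both cases of the theorem come from this one estimate; they differ only in the
    value of the weighted integral \<open>J\<close>.\<close>
  have main: "\<bar>(f a + f b) / 2 - 1 / (b - a) * integral {a..b} f\<bar> \<le> (b - a) / 2 * ?M * J"
    if le1: "\<eta> \<le> 1" and J: "((\<lambda>t. (1 - t)\<^sup>2 * exp (?u * t)) has_integral J) {0..1}" for J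
  proof (rule trapezoid_error_le_exp[where f' = "deriv f", OF ab(2) _ _ _ _ J])
    fix x assume "x \<in> {a..b}"
    then have "x \<in> I" "x \<in> {0..b / m}" using I(3) ab b_le by auto
    show "DERIV f x :> deriv f x"
      using f_diff[OF \<open>x \<in> I\<close>] by (simp add: DERIV_deriv_iff_real_differentiable)
    show "deriv f x \<noteq> 0" using pos[OF \<open>x \<in> {0..b / m}\<close>] by simp
  next
    fix t :: real assume t: "t \<in> {0..1}"
    \<comment> \<open>Taking b / m as second point cancels the factor m, so the convexity inequality
      speaks of the segment from b to a.\<close>
    have "b - (b - a) * t = t * a + m * (1 - t) * (b / m)"
      using m by (simp add: field_simps)
    then show "\<bar>deriv f (b - (b - a) * t)\<bar> \<le> ?M * exp (?u * t)"
      using alpha_m_log_convex_on_segment_le[OF f'_conv \<alpha> a_in b_in \<eta> le1 t] by simp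
  next
    show "?u \<le> 0" using \<alpha> le1 \<eta>_pos by (simp add: mult_nonneg_nonpos)
  qed
  show ?thesis
  proof (intro conjI impI)
    assume "\<eta> = 1"
    then have "\<bar>(f a + f b) / 2 - 1 / (b - a) * integral {a..b} f\<bar> \<le> (b - a) / 2 * ?M * (1 / 3)"
      using has_integral_power2_one_minus by (intro main) simp_all
    \<comment> \<open>The estimate gives (b - a) / 6, half the claimed constant.\<close>
    also have "\<dots> \<le> (b - a) / 3 * ?M" using ab by (simp add: mult_right_mono)
    finally show "\<bar>(f a + f b) / 2 - 1 / (b - a) * integral {a..b} f\<bar> \<le> (b - a) / 3 * ?M" .
  next
    assume "\<eta> < 1"
    then have "?u \<noteq> 0" using \<alpha> \<eta>_pos by simp
    \<comment> \<open>With u = \<alpha> ln \<eta>, exp u is \<eta> to the power \<alpha>, so the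
      Taylor remainder becomes the stated fraction.\<close>
    from main[OF _ has_integral_taylor_remainder_exp[OF this]] \<open>\<eta> < 1\<close> \<eta>_pos
    show "\<bar>(f a + f b) / 2 - 1 / (b - a) * integral {a..b} f\<bar>
        \<le> (b - a) / 2 * ?M *
          ((- (\<alpha>\<^sup>2 * (ln \<eta>)\<^sup>2) - 2 * \<alpha> * ln \<eta> + 2 * \<eta> powr \<alpha> - 2) / (\<alpha> ^ 3 * (ln \<eta>) ^ 3))"
      by (simp add: power_mult_distrib powr_def mult.assoc)
  qed
qed

end
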